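(* Let $(X,\|\cdot\|)$ be a Banach space, let $B\subset X$ be a symmetric compact convex set, and for $t\ge 0$ define $$B_t := \{ y\in B : \exists\,z\in X^*\mbox{ such that } \langle z,y\rangle = \|y\|_B,~\|z\|_B^*\le 1,~\|z\|^*\le t\}.$$ Then for any $a>0$ $$\gamma_2(B) \lesssim \frac{1}{a} + \sum_{n\ge 0} 2^{n/2} e_n(B_{a2^{n/2}}).$$
   Context: $X$ is a real Banach space with dual $X^*$. The gauge of $B$ is $\|x\|_B:=\inf\{s\ge 0: x\in sB\}$ for $x\in X$ (equal to $+\infty$ if no such $s$ exists). For $z\in X^*$, $\|z\|_B^*:=\sup_{x\in B}\langle z,x\rangle$ and $\|z\|^*:=\sup_{\|x\|\le 1}\langle z,x\rangle$. The metric is $d(x,y):=\|x-y\|$. For $A\subseteq X$ and $n\ge 0$, the entropy number is $e_n(A):=\inf_{|\tilde A|<2^{2^n}}\sup_{x\in A}d(x,\tilde A)$, and $\gamma_2(A):=\inf_{|\tilde A_n|<2^{2^n}}\sup_{x\in A}\sum_{n\ge 0}2^{n/2}d(x,\tilde A_n)$, where the infima are over (sequences of) nonempty finite subsets of $X$ (not necessarily of $A$) of the indicated cardinality, and $d(x,S):=\inf_{s\in S}d(x,s)$. The notation $a\lesssim b$ means $a\le Cb$ for a universal constant $C$ (independent of $X$, $B$, and $a>0$). *)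

theory Defs
  imports "HOL-Analysis.Analysis"
begin

(* The value is \<infinity> when x lies in no sB, since Inf {} = \<infinity> in ereal. *)
definition gauge_norm :: "'a::real_vector set \<Rightarrow> 'a \<Rightarrow> ereal" where
  "gauge_norm B x = Inf {ereal s | s. 0 \<le> s \<and> x \<in> (\<lambda>b. s *\<^sub>R b) ` B}"

(* The dual space X* is the type of bounded linear functionals; blinfun_apply z x
   is the pairing of z with x. *)
definition dual_gauge :: "'a::real_normed_vector set \<Rightarrow> ('a \<Rightarrow>\<^sub>L real) \<Rightarrow> ereal" where
  "dual_gauge B z = (SUP x\<in>B. ereal (blinfun_apply z x))"

(* The dual norm is the library's operator norm; on real-valued functionals it is the
   supremum over the closed unit ball, including on the trivial space. *)
lemma norm_blinfun_eq_SUP_cball: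
  fixes z :: "'a::real_normed_vector \<Rightarrow>\<^sub>L real"
  shows "ereal (norm z) = (SUP x\<in>cball 0 1. ereal (blinfun_apply z x))"
proof (rule antisym)
  let ?S = "SUP x\<in>cball 0 1. ereal (blinfun_apply z x)"
  have up: "?S \<le> ereal (norm z)"
  proof (rule SUP_least)
    fix x :: 'a assume "x \<in> cball 0 1"
    then have "norm x \<le> 1" by simp
    have "blinfun_apply z x \<le> norm (blinfun_apply z x)" by simp
    also have "\<dots> \<le> norm z * norm x" by (rule norm_blinfun)
    also have "\<dots> \<le> norm z" using \<open>norm x \<le> 1\<close> by (simp add: mult_left_le)
    finally show "ereal (blinfun_apply z x) \<le> ereal (norm z)" by simp
  qed
  then show "?S \<le> ereal (norm z)" .
  have "ereal (blinfun_apply z 0) \<le> ?S" by (rule SUP_upper) simp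
  then have nonneg: "0 \<le> ?S" by (simp add: blinfun.zero_right zero_ereal_def)
  obtain r where r: "?S = ereal r" "0 \<le> r"
    using up nonneg by (cases ?S) auto
  have "norm z \<le> r"
  proof (rule norm_blinfun_bound[OF r(2)])
    fix x :: 'a
    have unit: "blinfun_apply z y \<le> r" if "norm y \<le> 1" for y
    proof -
      have "ereal (blinfun_apply z y) \<le> ?S" using that by (intro SUP_upper) simp
      then show ?thesis using r(1) by simp
    qed
    show "norm (blinfun_apply z x) \<le> r * norm x"
    proof (cases "x = 0")
      case True
      then show ?thesis by (simp add: blinfun.zero_right)
    next
      case False
      have "blinfun_apply z (x /\<^sub>R norm x) \<le> r" "blinfun_apply z (- (x /\<^sub>R norm x)) \<le> r"
        using False by (auto intro!: unit)
      then show ?thesis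
        using False by (simp add: blinfun.scaleR_right blinfun.minus_right field_simps abs_le_iff)
    qed
  qed
  then show "ereal (norm z) \<le> ?S" using r(1) by simp
qed

definition B_level :: "'a::real_normed_vector set \<Rightarrow> real \<Rightarrow> 'a set" where
  "B_level B t = {y \<in> B. \<exists>z :: 'a \<Rightarrow>\<^sub>L real.
     ereal (blinfun_apply z y) = gauge_norm B y \<and> dual_gauge B z \<le> 1 \<and> norm z \<le> t}"

(* Nets range over the whole space, not only over the set to be covered. *)
definition nets :: "nat \<Rightarrow> 'a set set" where
  "nets n = {S. finite S \<and> S \<noteq> {} \<and> card S < 2 ^ (2 ^ n)}"

definition entropy_number :: "nat \<Rightarrow> 'a::metric_space set \<Rightarrow> ennreal" where
  "entropy_number n A = (INF S\<in>nets n. SUP x\<in>A. ennreal (infdist x S))"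

definition gamma2 :: "'a::metric_space set \<Rightarrow> ennreal" where
  "gamma2 A = (INF S\<in>{S. \<forall>n. S n \<in> nets n}. SUP x\<in>A.
     \<Sum>n. ennreal (2 powr (real n / 2)) * ennreal (infdist x (S n)))"

(* An inequality up to a universal constant has to be stated with an explicit numeral:
   HOL cannot quantify over types inside a formula, so a constant bound by an existential
   quantifier in a statement about 'a :: banach could depend on the space 'a. *)

end

theory Submission imports Defs begin

text \<open>
  The proof interpolates between the gauge of \<open>B\<close> and the norm of the space.  For \<open>t \<ge> 0\<close> and \<open>x \<in> B\<close> put
  \<open>K t x = inf {s + t * norm (x - y) | s \<ge> 0, y \<in> s B}\<close>, and let \<open>y\<^sub>t\<close> be a point where the
  infimum is attained.  Two facts about the minimizers give the theorem.

  The first is that \<open>y\<^sub>t\<close> lies in the level set \<open>B_level B t\<close> (\<open>K_functional_minimizer\<close>).  Indeed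
  \<open>K t\<close> is a sublinear functional, so by Hahn--Banach some linear \<open>z \<le> K t\<close> touches it at \<open>x\<close>.
  Being below \<open>K t\<close> forces both dual bounds on \<open>z\<close>, and \<open>z x = K t x\<close> leaves no room for
  \<open>z y\<^sub>t\<close> to be smaller than the gauge of \<open>y\<^sub>t\<close>.

  The second is that the distances \<open>dist x y\<^sub>t\<close>, weighted by \<open>t\<close>, are summable along a geometric
  sequence of levels (\<open>sum_minimizer_distances\<close>).
  Comparing the infimum at \<open>t'\<close> with its value at the competitor \<open>y\<^sub>t\<close> gives
  \<open>(t - t') * dist x y\<^sub>t \<le> K t x - K t' x\<close>.  Write \<open>y\<^sub>n\<close> for the minimizer at
  level \<open>t\<^sub>n = a * 2 powr (n/2)\<close>.  Along these levels the bound telescopes, and \<open>0 \<le> K \<le> 1\<close> on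
  \<open>B\<close>, so \<open>\<Sum>n. 2 powr (n/2) * dist x y\<^sub>n\<close> is at most a constant over \<open>a\<close>; since
  \<open>1 - 1 / sqrt 2 > 1 / 4\<close>, the constant \<open>4\<close> suffices.

  A net \<open>S\<^sub>n\<close> that is nearly optimal for \<open>B_level B t\<^sub>n\<close> is at distance at most
  \<open>dist x y\<^sub>n + infdist y\<^sub>n S\<^sub>n\<close> from \<open>x\<close>, and the last term exceeds the entropy number of
  the level set by an arbitrarily small amount at most; summation over \<open>n\<close> bounds \<open>gamma2 B\<close> (\<open>gamma2_le_approximation\<close>).
\<close>

section \<open>Sublinear functionals and the Hahn--Banach theorem\<close>

text \<open>
  One inequality for positive scalars is enough: applied to \<open>inverse c\<close> it gives the reverse
  one, and applied to \<open>c = 2\<close> and \<open>c = 1/2\<close> at the origin it gives \<open>q 0 = 0\<close>.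
\<close>
definition sublinear :: "('a::real_vector \<Rightarrow> real) \<Rightarrow> bool" where
  "sublinear q \<longleftrightarrow> (\<forall>u v. q (u + v) \<le> q u + q v) \<and> (\<forall>u. \<forall>c>0. q (c *\<^sub>R u) \<le> c * q u)"

lemma sublinear_add: "sublinear q \<Longrightarrow> q (u + v) \<le> q u + q v"
  and sublinear_scale_le: "sublinear q \<Longrightarrow> c > 0 \<Longrightarrow> q (c *\<^sub>R u) \<le> c * q u"
  by (auto simp: sublinear_def)

lemma sublinear_zero: "sublinear q \<Longrightarrow> q 0 = 0"
  using sublinear_scale_le[of q 2 0] sublinear_scale_le[of q "1/2" 0] by simp

lemma sublinear_scale:
  assumes "sublinear q" "c \<ge> 0"
  shows "q (c *\<^sub>R u) = c * q u"
proof (cases "c = 0")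
  case True
  then show ?thesis using sublinear_zero[OF assms(1)] by simp
next
  case False
  then have c: "c > 0" using assms by simp
  have "q ((1/c) *\<^sub>R (c *\<^sub>R u)) \<le> (1/c) * q (c *\<^sub>R u)"
    using c by (intro sublinear_scale_le assms) auto
  then have "c * q u \<le> q (c *\<^sub>R u)" using c by (simp add: field_simps)
  then show ?thesis using sublinear_scale_le[OF assms(1) c, of u] by simp
qed

lemma sublinear_neg_le:
  assumes "sublinear q"
  shows "- q (- u) \<le> q u"
  using sublinear_add[OF assms, of u "- u"] sublinear_zero[OF assms] by simp

text \<open>
  The three infima used below (along chains, along rays, and over competitors in the
  interpolation functional) are sublinear for the same reason: two competitors, one for \<open>u\<close> and
  one for \<open>v\<close>, can be combined to a competitor for \<open>u + v\<close>, and competitors can be rescaled.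
\<close>
lemma sublinear_INF:
  fixes F :: "'i \<Rightarrow> 'a::real_vector \<Rightarrow> real"
  assumes ne: "I \<noteq> {}"
    and bdd: "\<And>u. bdd_below ((\<lambda>i. F i u) ` I)"
    and add: "\<And>i j u v. i \<in> I \<Longrightarrow> j \<in> I \<Longrightarrow> \<exists>k\<in>I. F k (u + v) \<le> F i u + F j v"
    and scale: "\<And>i c u. i \<in> I \<Longrightarrow> c > 0 \<Longrightarrow> \<exists>k\<in>I. F k (c *\<^sub>R u) \<le> c * F i u"
  shows "sublinear (\<lambda>u. INF i\<in>I. F i u)"
  unfolding sublinear_def
proof (intro conjI allI impI)
  fix u v :: 'a
  have le: "(INF k\<in>I. F k (u + v)) \<le> F i u + F j v" if ij: "i \<in> I" "j \<in> I" for i j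
    using add[OF ij, of u v] cINF_lower2[OF bdd] by blast
  have "(INF k\<in>I. F k (u + v)) - F j v \<le> (INF i\<in>I. F i u)" if "j \<in> I" for j
    using le[OF _ that] by (intro cINF_greatest[OF ne]) (simp add: algebra_simps)
  then have "(INF k\<in>I. F k (u + v)) - (INF i\<in>I. F i u) \<le> (INF j\<in>I. F j v)"
    by (intro cINF_greatest[OF ne]) (simp add: algebra_simps)
  then show "(INF k\<in>I. F k (u + v)) \<le> (INF i\<in>I. F i u) + (INF j\<in>I. F j v)" by simp
next
  fix u :: 'a and c :: real assume c: "c > 0"
  have "(INF k\<in>I. F k (c *\<^sub>R u)) / c \<le> F i u" if i: "i \<in> I" for i
  proof -
    have "(INF k\<in>I. F k (c *\<^sub>R u)) \<le> c * F i u"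
      using scale[OF i c, of u] cINF_lower2[OF bdd] by blast
    then show ?thesis using c by (simp add: field_simps)
  qed
  then have "(INF k\<in>I. F k (c *\<^sub>R u)) / c \<le> (INF i\<in>I. F i u)"
    by (intro cINF_greatest[OF ne])
  then show "(INF k\<in>I. F k (c *\<^sub>R u)) \<le> c * (INF i\<in>I. F i u)"
    using c by (simp add: field_simps)
qed

text \<open>
  The largest sublinear functional below \<open>q\<close> whose value at \<open>- v\<close> is at most \<open>- q v\<close>: it makes
  \<open>q\<close> linear along the line through \<open>v\<close>.
\<close>
definition linearize_along :: "'a::real_vector \<Rightarrow> ('a \<Rightarrow> real) \<Rightarrow> 'a \<Rightarrow> real" where
  "linearize_along v q u = (INF l\<in>{0..}. q (u + l *\<^sub>R v) - l * q v)"

lemma bdd_below_linearize_along: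
  assumes q: "sublinear q"
  shows "bdd_below ((\<lambda>l. q (u + l *\<^sub>R v) - l * q v) ` {0..})"
proof -
  have "- q (- u) \<le> q (u + l *\<^sub>R v) - l * q v" if "l \<ge> 0" for l
    using sublinear_add[OF q, of "u + l *\<^sub>R v" "- u"] sublinear_scale[OF q that, of v] by simp
  then show ?thesis by (intro bdd_belowI2) auto
qed

lemma linearize_along_le:
  assumes "sublinear q" "l \<ge> 0"
  shows "linearize_along v q u \<le> q (u + l *\<^sub>R v) - l * q v"
  unfolding linearize_along_def
  using assms by (intro cINF_lower bdd_below_linearize_along) auto

lemma sublinear_linearize_along:
  assumes q: "sublinear q"
  shows "sublinear (linearize_along v q)"
proof -
  have "sublinear (\<lambda>u. INF l\<in>{0..}. q (u + l *\<^sub>R v) - l * q v)"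
  proof (rule sublinear_INF)
    fix i j :: real and u w :: 'a assume ij: "i \<in> {0..}" "j \<in> {0..}"
    show "\<exists>k\<in>{0..}. q (u + w + k *\<^sub>R v) - k * q v
        \<le> (q (u + i *\<^sub>R v) - i * q v) + (q (w + j *\<^sub>R v) - j * q v)"
      using ij sublinear_add[OF q, of "u + i *\<^sub>R v" "w + j *\<^sub>R v"]
      by (intro bexI[of _ "i + j"]) (auto simp: algebra_simps)
  next
    fix i c :: real and u :: 'a assume ic: "i \<in> {0..}" "c > 0"
    show "\<exists>k\<in>{0..}. q (c *\<^sub>R u + k *\<^sub>R v) - k * q v \<le> c * (q (u + i *\<^sub>R v) - i * q v)"
      using ic sublinear_scale_le[OF q ic(2), of "u + i *\<^sub>R v"]
      by (intro bexI[of _ "c * i"]) (auto simp: algebra_simps)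
  qed (use bdd_below_linearize_along[OF q] in auto)
  then show ?thesis by (simp add: linearize_along_def[abs_def])
qed

text \<open>
  A minimal sublinear functional equals its own linearization along every \<open>v\<close>, and this says
  exactly that it is superadditive.
\<close>
lemma minimal_sublinear_is_linear:
  assumes q: "sublinear q"
    and minimal: "\<And>r. sublinear r \<Longrightarrow> (\<And>u. r u \<le> q u) \<Longrightarrow> r = q"
  shows "linear q"
proof -
  have add: "q (u + v) = q u + q v" for u v
  proof (rule antisym)
    have "linearize_along v q w \<le> q w" for w
      using linearize_along_le[OF q, of 0 v w] by simp
    then have "linearize_along v q = q"
      by (intro minimal sublinear_linearize_along q)
    then show "q u + q v \<le> q (u + v)"
      using linearize_along_le[OF q, of 1 v u] by simp
  qed (rule sublinear_add[OF q])
  have neg: "q (- u) = - q u" for u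
    using add[of u "- u"] sublinear_zero[OF q] by simp
  have "q (c *\<^sub>R u) = c * q u" for c u
  proof (cases "c \<ge> 0")
    case False
    then have "q (- ((- c) *\<^sub>R u)) = c * q u"
      using sublinear_scale[OF q, of "- c" u] neg[of "(- c) *\<^sub>R u"] by simp
    then show ?thesis by simp
  qed (rule sublinear_scale[OF q])
  then show ?thesis using add by (intro linearI) auto
qed

text \<open>
  Zorn's lemma gives a minimal sublinear functional.  The infimum of a chain is finite because
  every member \<open>f\<close> satisfies \<open>f u \<ge> - f (- u) \<ge> - p (- u)\<close>.
\<close>
lemma exists_linear_below_sublinear:
  fixes p :: "'a::real_vector \<Rightarrow> real"
  assumes p: "sublinear p"
  shows "\<exists>z. linear z \<and> (\<forall>u. z u \<le> p u)"
proof -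
  define A where "A = {q. sublinear q \<and> (\<forall>u. q u \<le> p u)}"
  define P where "P = (\<lambda>f g :: 'a \<Rightarrow> real. \<forall>u. g u \<le> f u)"
  have "\<exists>m\<in>A. \<forall>f\<in>A. P m f \<longrightarrow> f = m"
  proof (rule predicate_Zorn)
    show "partial_order_on A (relation_of P A)"
      by (rule partial_order_on_relation_ofI) (auto simp: P_def intro: order_trans intro!: ext order_antisym)
  next
    fix C assume C: "C \<in> Chains (relation_of P A)"
    then have CA: "C \<subseteq> A"
      by (auto simp: Chains_def relation_of_def)
    have chain: "P f g \<or> P g f" if "f \<in> C" "g \<in> C" for f g
      using C that by (auto simp: Chains_def relation_of_def)
    show "\<exists>u\<in>A. \<forall>f\<in>C. P f u"
    proof (cases "C = {}")
      case True
      then show ?thesis using p by (auto simp: A_def)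
    next
      case False
      have lower: "- p (- u) \<le> f u" if "f \<in> C" for f u
        using that CA sublinear_neg_le[of f u] unfolding A_def
        by (smt (verit) mem_Collect_eq subsetD)
      then have bdd: "bdd_below ((\<lambda>f. f u) ` C)" for u
        by (intro bdd_belowI2) auto
      have "sublinear (\<lambda>u. INF f\<in>C. f u)"
      proof (rule sublinear_INF[OF False bdd])
        fix f g u v assume fg: "f \<in> C" "g \<in> C"
        obtain h where h: "h \<in> C" "\<And>w. h w \<le> f w" "\<And>w. h w \<le> g w"
          using chain[OF fg] fg unfolding P_def by blast
        have "h (u + v) \<le> h u + h v"
          using h(1) CA sublinear_add unfolding A_def by blast
        also have "\<dots> \<le> f u + g v" using h by (intro add_mono)
        finally show "\<exists>k\<in>C. k (u + v) \<le> f u + g v" using h by blast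
      next
        fix f u and c :: real assume "f \<in> C" "c > 0"
        then show "\<exists>k\<in>C. k (c *\<^sub>R u) \<le> c * f u"
          using CA sublinear_scale_le unfolding A_def by blast
      qed
      moreover have "(INF f\<in>C. f u) \<le> p u" for u
      proof -
        obtain f where "f \<in> C" using False by blast
        then show ?thesis using CA unfolding A_def by (intro cINF_lower2[OF bdd]) auto
      qed
      ultimately have "(\<lambda>u. INF f\<in>C. f u) \<in> A" by (simp add: A_def)
      moreover have "P f (\<lambda>u. INF f\<in>C. f u)" if "f \<in> C" for f
        unfolding P_def using cINF_lower[OF bdd that] by simp
      ultimately show ?thesis by blast
    qed
  qed
  then obtain m where m: "m \<in> A" and min: "\<And>f. f \<in> A \<Longrightarrow> P m f \<Longrightarrow> f = m" by blast
  have "linear m"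
  proof (rule minimal_sublinear_is_linear)
    show "sublinear m" using m by (simp add: A_def)
    fix r assume r: "sublinear r" "\<And>u. r u \<le> m u"
    have "r u \<le> p u" for u using r(2)[of u] m unfolding A_def by (auto intro: order_trans)
    then show "r = m" using r by (intro min) (auto simp: A_def P_def)
  qed
  then show ?thesis using m by (auto simp: A_def)
qed

text \<open>
  A supporting functional at \<open>x\<close>: linear functionals below the linearization of \<open>p\<close> along \<open>x\<close>
  satisfy \<open>z (- x) \<le> - p x\<close>, that is \<open>z x \<ge> p x\<close>.
\<close>
theorem Hahn_Banach_support:
  fixes p :: "'a::real_vector \<Rightarrow> real"
  assumes p: "sublinear p"
  obtains z where "linear z" "\<And>u. z u \<le> p u" "z x = p x"
proof -
  obtain z where z: "linear z" "\<And>u. z u \<le> linearize_along x p u"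
    using exists_linear_below_sublinear[OF sublinear_linearize_along[OF p]] by blast
  have le: "z u \<le> p u" for u
    using z(2)[of u] linearize_along_le[OF p, of 0 x u] by simp
  have "z (- x) \<le> - p x"
    using z(2)[of "- x"] linearize_along_le[OF p, of 1 x "- x"] sublinear_zero[OF p] by simp
  then have "z x = p x" using le[of x] linear_neg[OF z(1), of x] by simp
  then show ?thesis using that z(1) le by blast
qed

section \<open>The interpolation functional and its minimizers\<close>

text \<open>
  Peetre's K-functional between the gauge of \<open>B\<close> and the norm.  The decomposition is
  parametrized by the scale \<open>s\<close> and the point \<open>b \<in> B\<close> instead of \<open>y = s b\<close>, which keeps it
  real-valued although the gauge may be infinite.
\<close>
definition K_functional :: "'a::real_normed_vector set \<Rightarrow> real \<Rightarrow> 'a \<Rightarrow> real" where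
  "K_functional B t x = (INF (s, b)\<in>{0..} \<times> B. s + t * norm (x - s *\<^sub>R b))"

lemma bdd_below_K_functional:
  "t \<ge> 0 \<Longrightarrow> bdd_below ((\<lambda>(s, b). s + t * norm (x - s *\<^sub>R b)) ` ({0..} \<times> B))"
  by (intro bdd_belowI2[of _ 0]) auto

lemma K_functional_le:
  assumes "t \<ge> 0" "s \<ge> 0" "b \<in> B"
  shows "K_functional B t x \<le> s + t * norm (x - s *\<^sub>R b)"
  unfolding K_functional_def
  using cINF_lower[OF bdd_below_K_functional[OF assms(1)], of "(s, b)"] assms by auto

lemma K_functional_nonneg:
  assumes "t \<ge> 0" "B \<noteq> {}"
  shows "K_functional B t x \<ge> 0"
  unfolding K_functional_def using assms by (intro cINF_greatest) auto

lemma K_functional_le_1: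
  assumes "t \<ge> 0" "x \<in> B"
  shows "K_functional B t x \<le> 1"
  using K_functional_le[OF assms(1), of 1 x B x] assms by simp

text \<open>
  Competitors \<open>i b\<close> and \<open>j c\<close> are combined to \<open>i b + j c\<close>, which by convexity is \<open>i + j\<close> times a
  point of \<open>B\<close>.
\<close>
lemma sublinear_K_functional:
  assumes "t \<ge> 0" "B \<noteq> {}" "convex B"
  shows "sublinear (K_functional B t)"
proof -
  have "sublinear (\<lambda>x. INF i\<in>{0..} \<times> B. (\<lambda>(s, b). s + t * norm (x - s *\<^sub>R b)) i)"
  proof (rule sublinear_INF)
    show "bdd_below ((\<lambda>i. (\<lambda>(s, b). s + t * norm (x - s *\<^sub>R b)) i) ` ({0..} \<times> B))" for x
      using bdd_below_K_functional[OF assms(1)] .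
  next
    fix p q :: "real \<times> 'a" and u v
    assume pq: "p \<in> {0..} \<times> B" "q \<in> {0..} \<times> B"
    obtain i b j c where eq: "p = (i, b)" "q = (j, c)" by (cases p; cases q)
    have nn: "i \<ge> 0" "j \<ge> 0" "b \<in> B" "c \<in> B" using pq eq by auto
    have "\<exists>w\<in>B. (i + j) *\<^sub>R w = i *\<^sub>R b + j *\<^sub>R c"
    proof (cases "i + j = 0")
      case True
      then have "i = 0" "j = 0" using nn by auto
      then show ?thesis using nn by auto
    next
      case False
      have "(i / (i + j)) *\<^sub>R b + (j / (i + j)) *\<^sub>R c \<in> B"
        using False nn by (intro convexD[OF assms(3)]) (auto simp: add_divide_distrib[symmetric])
      moreover have "(i + j) *\<^sub>R ((i / (i + j)) *\<^sub>R b + (j / (i + j)) *\<^sub>R c) = i *\<^sub>R b + j *\<^sub>R c"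
        using False by (simp add: scaleR_add_right)
      ultimately show ?thesis by blast
    qed
    then obtain w where w: "w \<in> B" "(i + j) *\<^sub>R w = i *\<^sub>R b + j *\<^sub>R c" by blast
    have "norm (u + v - (i + j) *\<^sub>R w) \<le> norm (u - i *\<^sub>R b) + norm (v - j *\<^sub>R c)"
      using norm_triangle_ineq[of "u - i *\<^sub>R b" "v - j *\<^sub>R c"] w(2) by (simp add: algebra_simps)
    then have "t * norm (u + v - (i + j) *\<^sub>R w)
        \<le> t * norm (u - i *\<^sub>R b) + t * norm (v - j *\<^sub>R c)"
      using mult_left_mono[OF _ assms(1)] by (simp add: distrib_left[symmetric])
    then show "\<exists>k\<in>{0..} \<times> B. (\<lambda>(s, b). s + t * norm (u + v - s *\<^sub>R b)) k
        \<le> (\<lambda>(s, b). s + t * norm (u - s *\<^sub>R b)) p + (\<lambda>(s, b). s + t * norm (v - s *\<^sub>R b)) q"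
      using nn w(1) eq by (intro bexI[of _ "(i + j, w)"]) auto
  next
    fix p :: "real \<times> 'a" and c :: real and u
    assume p: "p \<in> {0..} \<times> B" and c: "c > 0"
    obtain i b where eq: "p = (i, b)" by (cases p)
    have "norm (c *\<^sub>R u - (c * i) *\<^sub>R b) = c * norm (u - i *\<^sub>R b)"
    proof -
      have "c *\<^sub>R u - (c * i) *\<^sub>R b = c *\<^sub>R (u - i *\<^sub>R b)" by (simp add: algebra_simps)
      then show ?thesis using c by simp
    qed
    then show "\<exists>k\<in>{0..} \<times> B. (\<lambda>(s, b). s + t * norm (c *\<^sub>R u - s *\<^sub>R b)) k
        \<le> c * (\<lambda>(s, b). s + t * norm (u - s *\<^sub>R b)) p"
      using p c eq by (intro bexI[of _ "(c * i, b)"]) (auto simp: algebra_simps)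
  qed (use assms in auto)
  then show ?thesis by (simp add: K_functional_def[abs_def])
qed

text \<open>
  For \<open>x \<in> B\<close> the competitor \<open>1 x\<close> has value \<open>1\<close>, so only scales in \<open>[0, 1]\<close> matter and compactness
  applies.
\<close>
lemma K_functional_attained:
  assumes "t \<ge> 0" "compact B" "x \<in> B"
  obtains s b where "0 \<le> s" "s \<le> 1" "b \<in> B" "K_functional B t x = s + t * norm (x - s *\<^sub>R b)"
proof -
  let ?f = "\<lambda>(s, b). s + t * norm (x - s *\<^sub>R b)"
  have "compact ({0..1::real} \<times> B)" using assms(2) by (intro compact_Times) auto
  moreover have "{0..1::real} \<times> B \<noteq> {}" using assms(3) by auto
  moreover have "continuous_on ({0..1} \<times> B) ?f"
    unfolding case_prod_unfold by (intro continuous_intros)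
  ultimately have "\<exists>q\<in>{0..1} \<times> B. \<forall>r\<in>{0..1} \<times> B. ?f q \<le> ?f r"
    by (rule continuous_attains_inf)
  then obtain q where q: "q \<in> {0..1} \<times> B" "\<forall>r\<in>{0..1} \<times> B. ?f q \<le> ?f r"
    by (elim bexE) (rule that)
  obtain s b where sb: "q = (s, b)" by (cases q)
  have min: "s + t * norm (x - s *\<^sub>R b) \<le> r + t * norm (x - r *\<^sub>R c)" if "r \<ge> 0" "c \<in> B" for r c
  proof (cases "r \<le> 1")
    case True
    then show ?thesis using bspec[OF q(2), of "(r, c)"] sb that by simp
  next
    case False
    have "s + t * norm (x - s *\<^sub>R b) \<le> 1" using bspec[OF q(2), of "(1, x)"] sb assms(3) by simp
    moreover have "0 \<le> t * norm (x - r *\<^sub>R c)" using assms(1) by simp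
    ultimately show ?thesis using False by simp
  qed
  have s: "0 \<le> s" "s \<le> 1" "b \<in> B" using q(1) sb by auto
  have "s + t * norm (x - s *\<^sub>R b) \<le> K_functional B t x"
    unfolding K_functional_def using min assms(3) by (intro cINF_greatest) auto
  then have "K_functional B t x = s + t * norm (x - s *\<^sub>R b)"
    using K_functional_le[OF assms(1) s(1) s(3), of x] by simp
  then show ?thesis using that s by blast
qed

text \<open>
  The dual certificate that puts the minimizer \<open>y = s b\<close> into the level set is a supporting
  functional \<open>z\<close> of \<open>K t\<close> at \<open>x\<close>: the bounds \<open>z y \<le> s\<close> and \<open>z (x - y) \<le> t * norm (x - y)\<close> add up to
  \<open>z x \<le> K t x\<close>, which is an equality, so both are equalities.  The second conclusion tests
  \<open>K t'\<close> with the same \<open>y\<close>: the values at \<open>t\<close> and \<open>t'\<close> differ by \<open>(t - t') * dist x y\<close>.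
\<close>
lemma K_functional_minimizer:
  fixes B :: "'a::real_normed_vector set"
  assumes sym: "\<forall>x\<in>B. - x \<in> B" and "compact B" "convex B" and t: "t \<ge> 0" and x: "x \<in> B"
  obtains y where "y \<in> B_level B t"
    "\<And>t'. t' \<ge> 0 \<Longrightarrow> (t - t') * dist x y \<le> K_functional B t x - K_functional B t' x"
proof -
  obtain s b where s: "0 \<le> s" "s \<le> 1" and b: "b \<in> B"
    and K: "K_functional B t x = s + t * norm (x - s *\<^sub>R b)"
    using K_functional_attained[OF t assms(2) x] by blast
  let ?y = "s *\<^sub>R b"
  have "(1/2) *\<^sub>R x + (1/2) *\<^sub>R (- x) \<in> B"
    using x sym by (intro convexD[OF assms(3)]) auto
  then have zero: "0 \<in> B" by simp
  have "s *\<^sub>R b + (1 - s) *\<^sub>R 0 \<in> B"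
    using zero b s by (intro convexD[OF assms(3)]) auto
  then have yB: "?y \<in> B" by simp
  have gauge: "gauge_norm B ?y = ereal s"
    unfolding gauge_norm_def
  proof (rule antisym)
    show "Inf {ereal r |r. 0 \<le> r \<and> ?y \<in> (*\<^sub>R) r ` B} \<le> ereal s"
      using s b by (intro Inf_lower) auto
    show "ereal s \<le> Inf {ereal r |r. 0 \<le> r \<and> ?y \<in> (*\<^sub>R) r ` B}"
    proof (rule Inf_greatest)
      fix v assume "v \<in> {ereal r |r. 0 \<le> r \<and> ?y \<in> (*\<^sub>R) r ` B}"
      then obtain r c where r: "v = ereal r" "0 \<le> r" "c \<in> B" "?y = r *\<^sub>R c" by auto
      show "ereal s \<le> v" using K_functional_le[OF t r(2,3), of x] K r by simp
    qed
  qed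
  obtain z where z: "linear z" "\<And>u. z u \<le> K_functional B t u" "z x = K_functional B t x"
    using Hahn_Banach_support[OF sublinear_K_functional[OF t _ assms(3)]] x by blast
  have zt: "z u \<le> t * norm u" for u
    using z(2)[of u] K_functional_le[OF t order.refl b, of u] by simp
  have zabs: "\<bar>z u\<bar> \<le> norm u * t" for u
    using zt[of u] zt[of "- u"] linear_neg[OF z(1), of u] by (simp add: mult.commute abs_le_iff)
  then have "bounded_linear z"
    using z(1) by (intro bounded_linear_intro[where K = t]) (auto simp: linear_add linear_scale)
  then have app: "blinfun_apply (Blinfun z) = z" by (rule bounded_linear_Blinfun_apply)
  have zB: "z c \<le> 1" if "c \<in> B" for c
    using z(2)[of c] K_functional_le_1[OF t that] by simp
  have "z ?y = s"
  proof (rule antisym)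
    show "z ?y \<le> s" using zB[OF b] s by (simp add: linear_scale[OF z(1)] mult_left_le)
    have "z x = z ?y + z (x - ?y)" using linear_diff[OF z(1), of x ?y] by simp
    then show "s \<le> z ?y" using zt[of "x - ?y"] z(3) K by simp
  qed
  moreover have "dual_gauge B (Blinfun z) \<le> 1"
    unfolding dual_gauge_def app using zB by (intro SUP_least) auto
  moreover have "norm (Blinfun z) \<le> t"
    using zabs by (intro norm_blinfun_bound t) (auto simp: app mult.commute)
  ultimately have "?y \<in> B_level B t"
    unfolding B_level_def using yB gauge by (auto simp: app intro!: exI[of _ "Blinfun z"])
  moreover have "(t - t') * dist x ?y \<le> K_functional B t x - K_functional B t' x" if "t' \<ge> 0" for t'
    using K_functional_le[OF that s(1) b, of x] K by (simp add: dist_norm algebra_simps)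
  ultimately show ?thesis using that by blast
qed

section \<open>Chaining along the minimizers\<close>

lemma two_powr_half_Suc_diff:
  "2 powr (real (Suc n) / 2) / 4 \<le> 2 powr (real (Suc n) / 2) - 2 powr (real n / 2)"
proof -
  have "2 powr (real (Suc n) / 2) = 2 powr (1/2) * 2 powr (real n / 2)"
    by (simp add: powr_add[symmetric] add_divide_distrib)
  then have eq: "2 powr (real (Suc n) / 2) = sqrt 2 * 2 powr (real n / 2)"
    by (simp add: powr_half_sqrt)
  have "4 / 3 \<le> sqrt (2::real)" by (rule real_le_rsqrt) (simp add: power2_eq_square)
  then have "4 / 3 * 2 powr (real n / 2) \<le> sqrt 2 * 2 powr (real n / 2)"
    by (rule mult_right_mono) simp
  then show ?thesis unfolding eq by simp
qed

text \<open>
  The hypothesis is what \<open>K_functional_minimizer\<close> gives along the levels \<open>a * 2 powr (n/2)\<close>; the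
  level \<open>t' = 0\<close> takes care of the first term and consecutive levels of the others.
\<close>
lemma sum_minimizer_distances:
  fixes K :: "real \<Rightarrow> real" and d :: "nat \<Rightarrow> real"
  assumes a: "a > 0" and d: "\<And>n. d n \<ge> 0"
    and K0: "K 0 \<ge> 0" and K1: "\<And>t. t \<ge> 0 \<Longrightarrow> K t \<le> 1"
    and incr: "\<And>n t'. t' \<ge> 0 \<Longrightarrow>
      (a * 2 powr (real n / 2) - t') * d n \<le> K (a * 2 powr (real n / 2)) - K t'"
  shows "(\<Sum>n. ennreal (2 powr (real n / 2)) * ennreal (d n)) \<le> 4 * ennreal (1 / a)"
proof -
  let ?t = "\<lambda>n. a * 2 powr (real n / 2)"
  have partial: "(\<Sum>n<Suc N. ?t n * d n) \<le> 4 * K (?t N)" for N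
  proof (induction N)
    case 0
    have "a * d 0 \<le> K a" using incr[of 0 0] K0 by simp
    moreover have "0 \<le> a * d 0" using a d[of 0] by simp
    ultimately show ?case by simp
  next
    case (Suc N)
    have "?t (Suc N) / 4 \<le> ?t (Suc N) - ?t N"
      using mult_left_mono[OF two_powr_half_Suc_diff[of N] less_imp_le[OF a]]
      by (simp add: algebra_simps)
    then have "?t (Suc N) / 4 * d (Suc N) \<le> (?t (Suc N) - ?t N) * d (Suc N)"
      by (rule mult_right_mono) (rule d)
    also have "\<dots> \<le> K (?t (Suc N)) - K (?t N)"
      using a by (intro incr) simp
    finally show ?case using Suc.IH by simp
  qed
  have fin: "(\<Sum>n<N. 2 powr (real n / 2) * d n) \<le> 4 / a" for N
  proof -
    have "(\<Sum>n<N. ?t n * d n) \<le> (\<Sum>n<Suc N. ?t n * d n)"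
      using a d by (intro sum_mono2) auto
    also have "\<dots> \<le> 4 * K (?t N)" by (rule partial)
    also have "\<dots> \<le> 4" using K1[of "?t N"] a by simp
    finally have "a * (\<Sum>n<N. 2 powr (real n / 2) * d n) \<le> 4"
      by (simp add: sum_distrib_left mult.assoc)
    then show ?thesis using a by (simp add: field_simps)
  qed
  have "(\<Sum>n. ennreal (2 powr (real n / 2) * d n)) \<le> ennreal (4 / a)"
  proof (rule suminf_le_const)
    show "summable (\<lambda>n. ennreal (2 powr (real n / 2) * d n))" by simp
    show "(\<Sum>n<N. ennreal (2 powr (real n / 2) * d n)) \<le> ennreal (4 / a)" for N
      using fin[of N] d by (subst sum_ennreal) (auto intro!: ennreal_leI)
  qed
  moreover have "ennreal (4 / a) = 4 * ennreal (1 / a)"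
    using ennreal_mult'[of 4 "1 / a"] by simp
  ultimately show ?thesis using d by (simp add: ennreal_mult)
qed

lemma near_optimal_net:
  fixes A :: "'a::metric_space set"
  assumes "\<delta> > 0"
  obtains S where "S \<in> nets n"
    "\<And>y. y \<in> A \<Longrightarrow> ennreal (infdist y S) \<le> entropy_number n A + ennreal \<delta>"
proof (cases "entropy_number n A = top")
  case True
  have "(1::nat) < 2 ^ (2 ^ n)" by (rule one_less_power) auto
  then have "{undefined :: 'a} \<in> nets n"
    unfolding nets_def by simp
  then show ?thesis using that[of "{undefined}"] True by simp
next
  case False
  then have "entropy_number n A < entropy_number n A + ennreal \<delta>"
    using assms ennreal_add_left_cancel_less[of "entropy_number n A" 0 "ennreal \<delta>"] by simp
  then obtain S where S: "S \<in> nets n"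
    "(SUP x\<in>A. ennreal (infdist x S)) < entropy_number n A + ennreal \<delta>"
    using entropy_number_def[of n A] by (auto simp: INF_less_iff)
  have "ennreal (infdist y S) \<le> entropy_number n A + ennreal \<delta>" if "y \<in> A" for y
    using SUP_upper[OF that, of "\<lambda>x. ennreal (infdist x S)"] S(2) by auto
  then show ?thesis using that S(1) by blast
qed

text \<open>
  If every point of \<open>A\<close> is approximated by points of sets \<open>A' n\<close> at total weighted cost \<open>c\<close>, then
  chaining through nearly optimal nets of the \<open>A' n\<close> costs only their entropy numbers on top.
\<close>
lemma gamma2_le_approximation:
  fixes A :: "'a::metric_space set"
  assumes approx: "\<And>x. x \<in> A \<Longrightarrow> \<exists>y. (\<forall>n. y n \<in> A' n) \<and>
      (\<Sum>n. ennreal (2 powr (real n / 2)) * ennreal (dist x (y n))) \<le> c"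
  shows "gamma2 A \<le> c + (\<Sum>n. ennreal (2 powr (real n / 2)) * entropy_number n (A' n))"
proof (rule ennreal_le_epsilon)
  let ?w = "\<lambda>n::nat. 2 powr (real n / 2) :: real"
  fix \<epsilon> :: real assume e: "\<epsilon> > 0"
  \<comment> \<open>The slack allowed at level \<open>n\<close> is chosen so that the weighted slacks sum to \<open>\<epsilon>\<close>.\<close>
  define \<delta> where "\<delta> n = \<epsilon> * (1/2) ^ Suc n / ?w n" for n
  have \<delta>: "\<delta> n > 0" for n using e by (simp add: \<delta>_def)
  have "\<exists>S. S \<in> nets n \<and>
      (\<forall>y\<in>A' n. ennreal (infdist y S) \<le> entropy_number n (A' n) + ennreal (\<delta> n))" for n
    using near_optimal_net[OF \<delta>[of n]] by metis
  then obtain S where S: "\<And>n. S n \<in> nets n"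
    "\<And>n y. y \<in> A' n \<Longrightarrow> ennreal (infdist y (S n)) \<le> entropy_number n (A' n) + ennreal (\<delta> n)"
    by metis
  have slack: "(\<Sum>n. ennreal (?w n) * ennreal (\<delta> n)) = ennreal \<epsilon>"
  proof -
    have "(\<lambda>n. \<epsilon> * (1/2) ^ Suc n) sums (\<epsilon> * 1)"
      by (intro sums_mult power_half_series)
    then have "(\<Sum>n. ennreal (\<epsilon> * (1/2) ^ Suc n)) = ennreal (\<epsilon> * 1)"
      using e by (intro suminf_ennreal_eq) auto
    moreover have "ennreal (?w n) * ennreal (\<delta> n) = ennreal (\<epsilon> * (1/2) ^ Suc n)" for n
      using \<delta>[of n] by (subst ennreal_mult[symmetric]) (auto simp: \<delta>_def)
    ultimately show ?thesis by simp
  qed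
  have "gamma2 A \<le> (SUP x\<in>A. \<Sum>n. ennreal (?w n) * ennreal (infdist x (S n)))"
    unfolding gamma2_def using S(1) by (intro INF_lower) simp
  also have "\<dots> \<le> c + (\<Sum>n. ennreal (?w n) * entropy_number n (A' n)) + ennreal \<epsilon>"
  proof (rule SUP_least)
    fix x assume "x \<in> A"
    then obtain y where y: "\<And>n. y n \<in> A' n"
      "(\<Sum>n. ennreal (?w n) * ennreal (dist x (y n))) \<le> c"
      using approx by blast
    have "ennreal (infdist x (S n))
        \<le> ennreal (dist x (y n)) + (entropy_number n (A' n) + ennreal (\<delta> n))" for n
    proof -
      have "ennreal (infdist x (S n)) \<le> ennreal (dist x (y n) + infdist (y n) (S n))"
        using infdist_triangle[of x "S n" "y n"] by (intro ennreal_leI) simp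
      also have "\<dots> = ennreal (dist x (y n)) + ennreal (infdist (y n) (S n))"
        by (simp add: infdist_nonneg)
      also have "\<dots> \<le> ennreal (dist x (y n)) + (entropy_number n (A' n) + ennreal (\<delta> n))"
        by (intro add_left_mono S(2) y(1))
      finally show ?thesis .
    qed
    then have "(\<Sum>n. ennreal (?w n) * ennreal (infdist x (S n)))
        \<le> (\<Sum>n. ennreal (?w n) *
            (ennreal (dist x (y n)) + (entropy_number n (A' n) + ennreal (\<delta> n))))"
      by (intro suminf_le mult_left_mono) auto
    also have "\<dots> = (\<Sum>n. ennreal (?w n) * ennreal (dist x (y n)))
        + ((\<Sum>n. ennreal (?w n) * entropy_number n (A' n)) + ennreal \<epsilon>)"
      by (simp add: distrib_left suminf_add[symmetric] slack)
    also have "\<dots> \<le> c + (\<Sum>n. ennreal (?w n) * entropy_number n (A' n)) + ennreal \<epsilon>"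
      using y(2) by (simp add: add.assoc add_right_mono)
    finally show "(\<Sum>n. ennreal (?w n) * ennreal (infdist x (S n)))
        \<le> c + (\<Sum>n. ennreal (?w n) * entropy_number n (A' n)) + ennreal \<epsilon>" .
  qed
  finally show "gamma2 A \<le> c + (\<Sum>n. ennreal (?w n) * entropy_number n (A' n)) + ennreal \<epsilon>" .
qed

theorem theorem1p2:
  fixes B :: "'a::banach set" and a :: real
  assumes symmetric: "\<forall>x\<in>B. - x \<in> B"
    and "compact B"
    and "convex B"
    and "a > 0"
  shows "gamma2 B \<le> 4 * (ennreal (1 / a) +
    (\<Sum>n. ennreal (2 powr (real n / 2)) *
       entropy_number n (B_level B (a * 2 powr (real n / 2)))))"
proof -
  let ?t = "\<lambda>n::nat. a * 2 powr (real n / 2)"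
  let ?E = "\<Sum>n. ennreal (2 powr (real n / 2)) * entropy_number n (B_level B (?t n))"
  have "gamma2 B \<le> 4 * ennreal (1 / a) + ?E"
  proof (rule gamma2_le_approximation)
    fix x assume x: "x \<in> B"
    have "\<exists>y. y \<in> B_level B (?t n) \<and> (\<forall>t'\<ge>0.
        (?t n - t') * dist x y \<le> K_functional B (?t n) x - K_functional B t' x)" for n
    proof -
      have "0 \<le> ?t n" using \<open>a > 0\<close> by simp
      then show ?thesis using K_functional_minimizer[OF assms(1-3) _ x] by metis
    qed
    then obtain y where y: "\<And>n. y n \<in> B_level B (?t n)"
      "\<And>n t'. t' \<ge> 0 \<Longrightarrow>
        (?t n - t') * dist x (y n) \<le> K_functional B (?t n) x - K_functional B t' x"
      by metis
    have "(\<Sum>n. ennreal (2 powr (real n / 2)) * ennreal (dist x (y n))) \<le> 4 * ennreal (1 / a)"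
      using \<open>a > 0\<close> x y(2) K_functional_nonneg[of 0 B x] K_functional_le_1[OF _ x]
      by (intro sum_minimizer_distances[where K = "\<lambda>t. K_functional B t x"]) auto
    then show "\<exists>y. (\<forall>n. y n \<in> B_level B (?t n)) \<and>
        (\<Sum>n. ennreal (2 powr (real n / 2)) * ennreal (dist x (y n))) \<le> 4 * ennreal (1 / a)"
      using y(1) by blast
  qed
  also have "\<dots> \<le> 4 * ennreal (1 / a) + 4 * ?E"
  proof (rule add_left_mono)
    have "1 * ?E \<le> 4 * ?E" by (rule mult_right_mono) auto
    then show "?E \<le> 4 * ?E" by simp
  qed
  finally show ?thesis by (simp add: distrib_left)
qed

end
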